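(* Let $G$ be a finite connected bipartite graph with diameter $d$, and let $t$ be a vertex of $G$. Suppose $G$ has a partition into $p\ge 2$ paths $P_1,\dots,P_p$ such that $t\in P_1$ and, for every $j\in\{2,\dots,p\}$, $P_j$ has at least $d^2$ vertices and the distance in $G$ between the two end vertices of $P_j$ is not in $\{2,4\}$. Then $G$ is $t$-stackable.
   Context: A partition of $G$ into paths means a collection of vertex-disjoint paths in $G$ (not necessarily induced) covering all vertices. Cup stacking on a finite connected graph $G$: initially one cup on every vertex; a move takes all $r\ge1$ cups from a vertex $x$ onto a vertex $y\neq x$ that already carries at least one cup and satisfies $d(x,y)=r$ (shortest-path distance in $G$). $G$ is $t$-stackable if some sequence of moves ends with all cups on $t$. *)

theory Defs
  imports Main "HOL-Library.Disjoint_Sets"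
begin

definition finite_graph :: "'a set \<Rightarrow> 'a set set \<Rightarrow> bool" where
  "finite_graph V E \<longleftrightarrow> finite V \<and> (\<forall>e\<in>E. e \<subseteq> V \<and> card e = 2)"

definition graph_walk :: "'a set \<Rightarrow> 'a set set \<Rightarrow> 'a list \<Rightarrow> bool" where
  "graph_walk V E xs \<longleftrightarrow> xs \<noteq> [] \<and> set xs \<subseteq> V \<and> successively (\<lambda>u v. {u, v} \<in> E) xs"

definition graph_path :: "'a set \<Rightarrow> 'a set set \<Rightarrow> 'a list \<Rightarrow> bool" where
  "graph_path V E xs \<longleftrightarrow> graph_walk V E xs \<and> distinct xs"

definition connected_graph :: "'a set \<Rightarrow> 'a set set \<Rightarrow> bool" where
  "connected_graph V E \<longleftrightarrow>
     V \<noteq> {} \<and> (\<forall>u\<in>V. \<forall>v\<in>V. \<exists>xs. graph_walk V E xs \<and> hd xs = u \<and> last xs = v)"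

definition bipartite_graph :: "'a set \<Rightarrow> 'a set set \<Rightarrow> bool" where
  "bipartite_graph V E \<longleftrightarrow>
     (\<exists>A B. A \<union> B = V \<and> A \<inter> B = {} \<and> (\<forall>e\<in>E. \<exists>a\<in>A. \<exists>b\<in>B. e = {a, b}))"

text \<open>Distance and diameter are meaningful only for connected graphs
  (and, for the diameter, finite nonempty ones).\<close>

definition gdist :: "'a set \<Rightarrow> 'a set set \<Rightarrow> 'a \<Rightarrow> 'a \<Rightarrow> nat" where
  "gdist V E u v =
     (LEAST n. \<exists>xs. graph_walk V E xs \<and> hd xs = u \<and> last xs = v \<and> length xs = n + 1)"

definition graph_diameter :: "'a set \<Rightarrow> 'a set set \<Rightarrow> nat" where
  "graph_diameter V E = Max {gdist V E u v | u v. u \<in> V \<and> v \<in> V}"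

definition path_partition :: "'a set \<Rightarrow> 'a set set \<Rightarrow> nat \<Rightarrow> (nat \<Rightarrow> 'a list) \<Rightarrow> bool" where
  "path_partition V E p P \<longleftrightarrow>
     (\<forall>i\<in>{1..p}. graph_path V E (P i)) \<and>
     disjoint_family_on (\<lambda>i. set (P i)) {1..p} \<and>
     (\<Union>i\<in>{1..p}. set (P i)) = V"

text \<open>A configuration maps each vertex to the number of cups on it.\<close>

definition initial_cups :: "'a set \<Rightarrow> 'a \<Rightarrow> nat" where
  "initial_cups V = (\<lambda>v. if v \<in> V then 1 else 0)"

definition cup_move :: "'a set \<Rightarrow> 'a set set \<Rightarrow> ('a \<Rightarrow> nat) \<Rightarrow> ('a \<Rightarrow> nat) \<Rightarrow> bool" where
  "cup_move V E c c' \<longleftrightarrow>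
     (\<exists>x\<in>V. \<exists>y\<in>V. x \<noteq> y \<and> c x \<ge> 1 \<and> c y \<ge> 1 \<and> gdist V E x y = c x \<and>
        c' = c(x := 0, y := c y + c x))"

definition stackable :: "'a set \<Rightarrow> 'a set set \<Rightarrow> 'a \<Rightarrow> bool" where
  "stackable V E t \<longleftrightarrow>
     (\<exists>c. (cup_move V E)\<^sup>*\<^sup>* (initial_cups V) c \<and> (\<forall>v\<in>V. v \<noteq> t \<longrightarrow> c v = 0))"

end

theory Submission
  imports Defs
begin

text \<open>
  A path with one cup on each vertex can be stacked onto either end \<open>t\<close>: if the other end \<open>z\<close> has
  distance \<open>k\<close> from \<open>t\<close>, stack (inductively) the last \<open>k\<close> vertices onto \<open>z\<close>, jump to \<open>t\<close>, and continue
  with the shorter path. Hence a path avoiding \<open>t\<close> can be brought onto \<open>t\<close> as soon as it can be cut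
  into segments each of which contains a vertex whose distance from \<open>t\<close> is the size of the segment.

  Along a path of a bipartite graph the distance to \<open>t\<close> changes by exactly one at each step. If the
  numbers \<open>x, \<dots>, x + w\<close> are all lengths of prefixes that can be cut up, then either all larger lengths
  can be reached or \<open>w\<close> can be increased, while \<open>x\<close> grows by at most \<open>d\<close>; at \<open>w = d - 1\<close> everything
  is reachable. The only obstruction is a path starting with distances \<open>2, 1\<close>. Then one starts from
  the other end instead; if both ends are of this kind, they have distance \<open>2\<close> or \<open>4\<close>.
\<close>

section \<open>Cutting a sequence into segments\<close>

text \<open>The values of \<open>f\<close> stand for the distances from the target of the successive
  vertices of a path. A segment of length \<open>f j\<close> has to contain position
  \<open>j\<close> itself, so that its cups can first be gathered there and then jump
  together.\<close>

inductive tileable :: "(nat \<Rightarrow> nat) \<Rightarrow> nat \<Rightarrow> bool" for f where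
  zero: "tileable f 0"
| tile: "tileable f k \<Longrightarrow> k \<le> j \<Longrightarrow> j < k + f j \<Longrightarrow> tileable f (k + f j)"

definition unit_steps :: "(nat \<Rightarrow> nat) \<Rightarrow> bool" where
  "unit_steps f \<longleftrightarrow> (\<forall>i. f (Suc i) = Suc (f i) \<or> f i = Suc (f (Suc i)))"

lemma unit_stepsD: "unit_steps f \<Longrightarrow> f (Suc i) = Suc (f i) \<or> f i = Suc (f (Suc i))"
  by (simp add: unit_steps_def)

lemma tile_to:
  assumes "tileable f k" "k \<le> j" "j < n" "n = k + f j"
  shows "tileable f n"
  using tileable.tile[OF assms(1,2)] assms(3,4) by simp

lemma tileable_cong:
  assumes "tileable f n" "\<And>i. i < n \<Longrightarrow> f i = g i"
  shows "tileable g n"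
  using assms
proof (induction rule: tileable.induct)
  case zero
  show ?case by (rule tileable.zero)
next
  case (tile k j)
  have "tileable g k" using tile by simp
  moreover have "f j = g j" using tile by simp
  ultimately show ?case using tile.hyps by (auto intro: tile_to)
qed

text \<open>A last segment measured at \<open>i\<close> must start at \<open>Suc y - f i\<close>; an
  \<open>i\<close> is sought for which this start is known to be tileable and does not exceed
  \<open>i\<close>. If \<open>j + f j\<close> overshoots \<open>Suc y\<close>, then \<open>j\<close>
  serves. Otherwise one walks right from \<open>j\<close> until \<open>i + f i\<close> reaches
  \<open>Suc y\<close>. As \<open>f\<close> rises by at most one per step, the start cannot fall to
  the left of the predecessor of \<open>i\<close>.\<close>

lemma tileable_Suc_of_interval:
  assumes steps: "unit_steps f" and pos: "\<And>i. f i \<ge> 1"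
    and L: "\<And>k. x \<le> k \<Longrightarrow> k \<le> y \<Longrightarrow> tileable f k"
    and j: "x \<le> j" "j \<le> y" "f j \<le> Suc y - x"
  shows "tileable f (Suc y)"
proof (cases "Suc y < j + f j")
  case True
  show ?thesis
    by (rule tile_to[of f "Suc y - f j" j]) (use True j L in auto)
next
  case False
  \<comment> \<open>The condition amounts to \<open>i + f i >= Suc y\<close>. It holds at
    \<open>y\<close> because \<open>f y >= 1\<close>, so the search ends inside the
    interval.\<close>
  define i where "i = (LEAST i. j \<le> i \<and> Suc y < Suc i + f i)"
  have ex: "j \<le> y \<and> Suc y < Suc y + f y" using j pos[of y] by auto
  have i: "j \<le> i \<and> Suc y < Suc i + f i" unfolding i_def by (rule LeastI) (rule ex)
  have iy: "i \<le> y" unfolding i_def by (rule Least_le) (rule ex)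
  show ?thesis
  proof (cases "i = j")
    case True
    then have "f j = Suc y - j" using i False by auto
    then show ?thesis by - (rule tile_to[of f j j], use j L in auto)
  next
    case ne: False
    then obtain m where m: "i = Suc m" "j \<le> m" using i by (cases i) auto
    have "\<not> (j \<le> m \<and> Suc y < Suc m + f m)"
      using not_less_Least[of m "\<lambda>i. j \<le> i \<and> Suc y < Suc i + f i"] m by (auto simp: i_def)
    then have *: "m + f m \<le> y" using m by auto
    have "f i \<le> Suc (f m)" using unit_stepsD[OF steps, of m] m by auto
    then have "f i \<le> Suc y - m" "f i \<ge> Suc y - i" using * i by auto
    then show ?thesis
      by - (rule tile_to[of f "Suc y - f i" i], use m j iy i in \<open>auto intro!: L\<close>)
  qed
qed

text \<open>One small value propagates for ever: the interval grows to the right while its left end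
  stays at \<open>x\<close>, so the requirement on \<open>f j\<close> only becomes weaker.\<close>

lemma tileable_from_interval:
  assumes steps: "unit_steps f" and pos: "\<And>i. f i \<ge> 1"
    and L: "\<And>k. x \<le> k \<Longrightarrow> k \<le> x + w \<Longrightarrow> tileable f k"
    and j: "x \<le> j" "j \<le> x + w" "f j \<le> Suc w"
    and k: "x \<le> k"
  shows "tileable f k"
proof -
  have "\<forall>k. x \<le> k \<longrightarrow> k \<le> x + w + m \<longrightarrow> tileable f k" for m
  proof (induction m)
    case 0
    show ?case using L by simp
  next
    case (Suc m)
    then have "tileable f (Suc (x + w + m))"
      using j by (intro tileable_Suc_of_interval[OF steps pos, where x=x and j=j]) auto
    with Suc show ?case by (auto simp: le_Suc_eq)
  qed
  from this[of k] k show ?thesis by simp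
qed

text \<open>Without a small value in the window, segments measured at its right end shift the whole
  window by at most \<open>d\<close>, and a segment measured a little further on contributes one
  more length at either end.\<close>

lemma tileable_interval_grows:
  assumes steps: "unit_steps f" and pos: "\<And>i. f i \<ge> 1" and bound: "\<And>i. f i \<le> d"
    and w: "w \<ge> 1"
    and L: "\<And>k. x \<le> k \<Longrightarrow> k \<le> x + w \<Longrightarrow> tileable f k"
  shows "(\<forall>k\<ge>x + d. tileable f k) \<or>
    (\<exists>x'\<le>x + d. \<forall>k. x' \<le> k \<longrightarrow> k \<le> x' + Suc w \<longrightarrow> tileable f k)"
proof (cases "\<exists>j. x \<le> j \<and> j \<le> x + w \<and> f j \<le> Suc w")
  case True
  then obtain j where "x \<le> j" "j \<le> x + w" "f j \<le> Suc w" by blast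
  from tileable_from_interval[OF steps pos L this] show ?thesis by auto
next
  case False
  define y v where "y = x + w" and "v = f y"
  have v: "v \<ge> w + 2" using False by (force simp: v_def y_def)
  have vd: "v \<le> d" using bound v_def by simp
  \<comment> \<open>Every start in the window admits a segment of length \<open>v\<close> around
    \<open>y\<close>, because \<open>y < x + v\<close>.\<close>
  have shift: "tileable f k" if "x + v \<le> k" "k \<le> y + v" for k
    by (rule tile_to[of f "k - v" y])
      (use that v L in \<open>auto simp: y_def v_def[symmetric, unfolded y_def]\<close>)
  \<comment> \<open>After a step up, a segment from \<open>y\<close> measured at
    \<open>Suc y\<close> adds a length on the right. After a step down, one from \<open>x\<close>
    adds a length on the left, provided that it is long enough to contain
    \<open>Suc y\<close>.\<close>
  consider (up) "f (Suc y) = Suc v" | (down) "v = Suc (f (Suc y))" "f (Suc y) \<ge> w + 2"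
    | (low) "v = w + 2" "f (Suc y) = w + 1"
    using unit_stepsD[OF steps, of y] v unfolding v_def by linarith
  then show ?thesis
  proof cases
    case up
    have "tileable f (y + Suc v)"
      by (rule tile_to[of f y "Suc y"]) (use up v L y_def in auto)
    with shift have "tileable f k" if "x + v \<le> k" "k \<le> x + v + Suc w" for k
      using that by (cases "k = y + Suc v") (auto simp: y_def)
    then show ?thesis using vd by (intro disjI2 exI[of _ "x + v"]) auto
  next
    case down
    have "tileable f (x + f (Suc y))"
      by (rule tile_to[of f x "Suc y"]) (use down v L y_def in auto)
    with shift have "tileable f k" if "x + f (Suc y) \<le> k" "k \<le> x + f (Suc y) + Suc w" for k
      using that down by (cases "k = x + f (Suc y)") (auto simp: y_def)
    then show ?thesis using bound by (intro disjI2 exI[of _ "x + f (Suc y)"]) auto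
  next
    case low
    \<comment> \<open>Here the segment from \<open>x\<close> of length \<open>w + 1\<close> stops
      just before \<open>Suc y\<close>. The first two values of the shifted window decide instead:
      either one of them is small, or they are \<open>w + 2\<close> and \<open>w + 3\<close>, and a
      segment from \<open>y\<close> gives the extra length.\<close>
    define x' where "x' = Suc (Suc y)"
    have x': "x' = x + v" using low by (simp add: x'_def y_def)
    have L': "tileable f k" if "x' \<le> k" "k \<le> x' + w" for k
      using shift that by (auto simp: x' y_def)
    have finish: ?thesis if "x' \<le> j" "j \<le> x' + w" "f j \<le> Suc w" for j
    proof -
      from tileable_from_interval[OF steps pos L' that] show ?thesis using vd x' by auto
    qed
    show ?thesis
    proof (cases "f x' \<le> Suc w \<or> f (Suc x') \<le> Suc w")
      case True
      then show ?thesis using finish[of x'] finish[of "Suc x'"] w by auto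
    next
      case False
      have "f x' = w + 2"
        using unit_stepsD[OF steps, of "Suc y"] False low by (auto simp: x'_def)
      then have f': "f (Suc x') = w + 3"
        using unit_stepsD[OF steps, of x'] False by auto
      have "tileable f (x' + Suc w)"
        by (rule tile_to[of f y "Suc x'"]) (use f' w L in \<open>auto simp: x'_def y_def\<close>)
      with L' have "tileable f k" if "x' \<le> k" "k \<le> x' + Suc w" for k
        using that by (cases "k = x' + Suc w") auto
      then show ?thesis using vd x' by (intro disjI2 exI[of _ x']) auto
    qed
  qed
qed

text \<open>The first segment gives a window of two consecutive lengths, and each round of growth
  widens it by one while moving it by at most \<open>d\<close>. Once the width is
  \<open>d - 1\<close>, every value counts as small.\<close>

lemma tileable_of_unit_steps:
  assumes steps: "unit_steps f" and pos: "\<And>i. f i \<ge> 1" and bound: "\<And>i. f i \<le> d"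
    and start: "\<not> (f 0 = 2 \<and> f 1 = 1)"
    and n: "n \<ge> d\<^sup>2"
  shows "tileable f n"
proof (cases "f 0 = 1")
  case True
  show ?thesis
    by (rule tileable_from_interval[OF steps pos, where x=0 and w=0 and j=0])
      (use True tileable.zero in auto)
next
  case False
  have f0: "f 0 \<ge> 2" using False pos[of 0] by simp
  have d2: "d \<ge> 2" using f0 bound[of 0] by simp
  have "(\<forall>k\<ge>Suc s * d. tileable f k) \<or>
    (\<exists>x\<le>Suc s * d. \<forall>k. x \<le> k \<longrightarrow> k \<le> x + Suc s \<longrightarrow> tileable f k)" for s
  proof (induction s)
    case 0
    define v where "v = min (f 0) (f 1)"
    have st: "f 1 = Suc (f 0) \<or> f 0 = Suc (f 1)" using unit_stepsD[OF steps, of 0] by simp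
    \<comment> \<open>\<open>f 1 = 1\<close> would force \<open>f 0 = 2\<close>, the excluded start.
      A first segment of length \<open>f 1\<close> contains position 1 only if
      \<open>f 1 >= 2\<close>.\<close>
    have f1: "f 1 \<ge> 2" using st start f0 pos[of 1] by auto
    have "tileable f (f 0)" "tileable f (f 1)"
      using f0 f1 by (auto intro: tile_to[OF tileable.zero, of 0] tile_to[OF tileable.zero, of 1])
    then have "tileable f k" if "v \<le> k" "k \<le> v + 1" for k
      using that st unfolding v_def by (auto simp: min_def le_Suc_eq split: if_splits)
    moreover have "v \<le> d" using bound[of 0] by (simp add: v_def)
    ultimately show ?case by auto
  next
    case (Suc s)
    then show ?case
    proof
      assume "\<forall>k\<ge>Suc s * d. tileable f k"
      then show ?thesis by auto
    next
      assume "\<exists>x\<le>Suc s * d. \<forall>k. x \<le> k \<longrightarrow> k \<le> x + Suc s \<longrightarrow> tileable f k"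
      then obtain x where x: "x \<le> Suc s * d"
        and L: "\<And>k. x \<le> k \<Longrightarrow> k \<le> x + Suc s \<Longrightarrow> tileable f k" by blast
      from tileable_interval_grows[OF steps pos bound _ L, where w="Suc s"]
      have "(\<forall>k\<ge>x + d. tileable f k) \<or>
        (\<exists>x'\<le>x + d. \<forall>k. x' \<le> k \<longrightarrow> k \<le> x' + Suc (Suc s) \<longrightarrow> tileable f k)" by (simp only: One_nat_def Suc_le_mono le0 simp_thms)
      moreover have "x + d \<le> Suc (Suc s) * d" using x by simp
      ultimately show ?thesis by (meson le_trans)
    qed
  qed
  \<comment> \<open>The window starts with \<open>w = 1\<close>, so \<open>d - 2\<close> rounds lead
    to \<open>w = d - 1\<close>, where the bound \<open>f x <= d\<close> is exactly
    \<open>f x <= Suc w\<close>.\<close>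
  from this[of "d - 2"] d2 have "(\<forall>k\<ge>(d - 1) * d. tileable f k) \<or>
    (\<exists>x\<le>(d - 1) * d. \<forall>k. x \<le> k \<longrightarrow> k \<le> x + (d - 1) \<longrightarrow> tileable f k)"
    by (simp add: Suc_diff_le numeral_2_eq_2 Suc_diff_Suc)
  moreover have dn: "(d - 1) * d \<le> n"
    using n by (simp add: power2_eq_square diff_mult_distrib)
  moreover have "tileable f n" if "x \<le> (d - 1) * d"
    "\<And>k. x \<le> k \<Longrightarrow> k \<le> x + (d - 1) \<Longrightarrow> tileable f k" for x
    by (rule tileable_from_interval[OF steps pos that(2), where x=x and w="d - 1" and j=x])
      (use bound[of x] that(1) dn d2 in auto)
  ultimately show ?thesis by blast
qed

text \<open>The version for finite paths, where nothing is known about \<open>f\<close> from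
  \<open>n\<close> on.\<close>

lemma tileable_of_unit_steps_below:
  assumes n: "n \<ge> 1" "n \<ge> d\<^sup>2"
    and steps: "\<And>i. Suc i < n \<Longrightarrow> f (Suc i) = Suc (f i) \<or> f i = Suc (f (Suc i))"
    and range: "\<And>i. i < n \<Longrightarrow> 1 \<le> f i \<and> f i \<le> d"
    and start: "\<not> (n \<ge> 2 \<and> f 0 = 2 \<and> f 1 = 1)"
  shows "tileable f n"
proof (cases "n \<ge> 2")
  case False
  \<comment> \<open>A single vertex leaves no step to repeat; here \<open>d\<close> must be 1, and
    the vertex is a segment by itself.\<close>
  then have "n = 1" using n by simp
  then have "d\<^sup>2 \<le> 1" "1 \<le> f 0" "f 0 \<le> d" using n range[of 0] by auto
  then have "f 0 = 1" using power_mono[of 2 d 2] by (cases "d \<le> 1") auto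
  then show ?thesis using \<open>n = 1\<close> by (intro tile_to[OF tileable.zero, of 0]) auto
next
  case True
  \<comment> \<open>Past its end, the sequence is continued by repeating its last two values.\<close>
  define e where "e i = (if i < n then i else if even (i - n) then n - 2 else n - 1)" for i
  have e: "e i < n" for i using True by (auto simp: e_def)
  have e_step: "e (Suc i) = Suc (e i) \<or> e i = Suc (e (Suc i))" for i
    using True by (auto simp: e_def Suc_diff_le not_less le_Suc_eq)
  have "tileable (f \<circ> e) n"
  proof (rule tileable_of_unit_steps)
    show "unit_steps (f \<circ> e)"
      unfolding unit_steps_def
    proof
      fix i
      from e_step[of i] show "(f \<circ> e) (Suc i) = Suc ((f \<circ> e) i) \<or> (f \<circ> e) i = Suc ((f \<circ> e) (Suc i))"
        using steps[of "e i"] steps[of "e (Suc i)"] e[of i] e[of "Suc i"] by auto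
    qed
    show "\<not> ((f \<circ> e) 0 = 2 \<and> (f \<circ> e) 1 = 1)" using start True by (auto simp: e_def)
  qed (use range e n in auto)
  then show ?thesis by (rule tileable_cong) (simp add: e_def)
qed

section \<open>Distances\<close>

lemma graph_walk_rev: "graph_walk V E (rev xs) \<longleftrightarrow> graph_walk V E xs"
  by (simp add: graph_walk_def insert_commute)

lemma graph_path_rev: "graph_path V E (rev xs) \<longleftrightarrow> graph_path V E xs"
  by (simp add: graph_path_def graph_walk_rev)

lemma graph_walk_append_iff:
  assumes "xs \<noteq> []" "ys \<noteq> []"
  shows "graph_walk V E (xs @ ys) \<longleftrightarrow>
    graph_walk V E xs \<and> graph_walk V E ys \<and> {last xs, hd ys} \<in> E"
  using assms by (auto simp: graph_walk_def successively_append_iff)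

lemma graph_path_appendD:
  assumes "graph_path V E (xs @ ys)"
  shows "xs \<noteq> [] \<Longrightarrow> graph_path V E xs" "ys \<noteq> [] \<Longrightarrow> graph_path V E ys"
  using assms by (auto simp: graph_path_def graph_walk_def successively_append_iff)

lemma gdist_le:
  assumes "graph_walk V E xs" "hd xs = u" "last xs = v"
  shows "gdist V E u v \<le> length xs - 1"
  unfolding gdist_def
  by (rule Least_le) (use assms in \<open>auto simp: graph_walk_def intro!: exI[of _ xs]\<close>)

lemma gdist_commute: "gdist V E u v = gdist V E v u"
proof -
  have imp: "(\<exists>xs. graph_walk V E xs \<and> hd xs = u \<and> last xs = v \<and> length xs = n + 1)
    \<Longrightarrow> (\<exists>xs. graph_walk V E xs \<and> hd xs = v \<and> last xs = u \<and> length xs = n + 1)" for n u v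
    by (metis graph_walk_rev hd_rev last_rev length_rev)
  have "(\<exists>xs. graph_walk V E xs \<and> hd xs = u \<and> last xs = v \<and> length xs = n + 1)
    \<longleftrightarrow> (\<exists>xs. graph_walk V E xs \<and> hd xs = v \<and> last xs = u \<and> length xs = n + 1)" for n
    by (rule iffI; rule imp)
  then show ?thesis unfolding gdist_def by (simp only:)
qed

section \<open>Distance and parity in connected bipartite graphs\<close>

locale connected_bipartite_graph =
  fixes V :: "'a set" and E :: "'a set set"
  assumes finite_graph: "finite_graph V E"
    and connected: "connected_graph V E"
    and bipartite: "bipartite_graph V E"
begin

abbreviation dist where "dist \<equiv> gdist V E"

lemma dist_walk:
  assumes "u \<in> V" "v \<in> V"
  obtains xs where "graph_walk V E xs" "hd xs = u" "last xs = v" "length xs = dist u v + 1"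
proof -
  obtain xs where "graph_walk V E xs" "hd xs = u" "last xs = v"
    using connected assms by (auto simp: connected_graph_def)
  moreover from this have "length xs = (length xs - 1) + 1"
    by (cases xs) (auto simp: graph_walk_def)
  ultimately have "\<exists>n xs. graph_walk V E xs \<and> hd xs = u \<and> last xs = v \<and> length xs = n + 1"
    by blast
  then have "\<exists>xs. graph_walk V E xs \<and> hd xs = u \<and> last xs = v \<and> length xs = dist u v + 1"
    unfolding gdist_def by (rule LeastI_ex)
  then show ?thesis using that by blast
qed

lemma dist_eq_0:
  assumes "u \<in> V" "v \<in> V"
  shows "dist u v = 0 \<longleftrightarrow> u = v"
proof
  assume "dist u v = 0"
  with dist_walk[OF assms] obtain xs where "hd xs = u" "last xs = v" "length xs = 1" by auto
  then show "u = v" by (auto simp: length_Suc_conv)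
next
  assume "u = v"
  then show "dist u v = 0" using gdist_le[of V E "[u]" u v] assms by (simp add: graph_walk_def)
qed

lemma dist_triangle:
  assumes "u \<in> V" "v \<in> V" "w \<in> V"
  shows "dist u w \<le> dist u v + dist v w"
proof -
  obtain xs where xs: "graph_walk V E xs" "hd xs = u" "last xs = v" "length xs = dist u v + 1"
    using dist_walk assms by metis
  obtain ys where ys: "graph_walk V E ys" "hd ys = v" "last ys = w" "length ys = dist v w + 1"
    using dist_walk assms by metis
  show ?thesis
  proof (cases "tl ys = []")
    case True
    then have "v = w" using ys by (cases ys) auto
    then show ?thesis by simp
  next
    case False
    then obtain zs where zs: "ys = v # zs" "zs \<noteq> []" using ys by (cases ys) auto
    have "graph_walk V E (xs @ zs)"
      using xs ys zs graph_walk_append_iff[of "[v]" zs V E] graph_walk_append_iff[of xs zs V E]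
      by (auto simp: graph_walk_def)
    from gdist_le[OF this] show ?thesis using xs ys zs by (auto simp: graph_walk_def)
  qed
qed

lemma bipartition:
  obtains A where "\<And>u v. {u, v} \<in> E \<Longrightarrow> u \<in> A \<longleftrightarrow> v \<notin> A"
proof -
  obtain A B where AB: "A \<inter> B = {}" "\<forall>e\<in>E. \<exists>a\<in>A. \<exists>b\<in>B. e = {a, b}"
    using bipartite by (auto simp: bipartite_graph_def)
  have "u \<in> A \<longleftrightarrow> v \<notin> A" if uv: "{u, v} \<in> E" for u v
  proof -
    obtain a b where "a \<in> A" "b \<in> B" "{u, v} = {a, b}" using AB(2) uv by blast
    then show ?thesis using AB(1) by (auto simp: doubleton_eq_iff)
  qed
  then show ?thesis using that by blast
qed

lemma walk_parity:
  assumes bip: "\<And>u v. {u, v} \<in> E \<Longrightarrow> u \<in> A \<longleftrightarrow> v \<notin> A"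
    and "graph_walk V E xs"
  shows "(hd xs \<in> A \<longleftrightarrow> last xs \<in> A) \<longleftrightarrow> odd (length xs)"
  using assms(2)
proof (induction xs)
  case Nil
  then show ?case by (simp add: graph_walk_def)
next
  case (Cons x xs)
  show ?case
  proof (cases "xs = []")
    case False
    then have "graph_walk V E xs" "{x, hd xs} \<in> E"
      using Cons.prems graph_walk_append_iff[of "[x]" xs V E] by auto
    then show ?thesis using Cons.IH bip[of x "hd xs"] False by auto
  qed simp
qed

lemma even_dist_iff:
  assumes bip: "\<And>u v. {u, v} \<in> E \<Longrightarrow> u \<in> A \<longleftrightarrow> v \<notin> A" and "u \<in> V" "v \<in> V"
  shows "even (dist u v) \<longleftrightarrow> (u \<in> A \<longleftrightarrow> v \<in> A)"
proof -
  obtain xs where xs: "graph_walk V E xs" "hd xs = u" "last xs = v" "length xs = dist u v + 1"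
    using dist_walk assms by metis
  with walk_parity[OF bip xs(1)] show ?thesis by auto
qed

text \<open>The triangle inequality bounds the difference by one, and parity excludes
  equality.\<close>

lemma dist_edge:
  assumes "{u, v} \<in> E" "t \<in> V"
  shows "dist u t = Suc (dist v t) \<or> dist v t = Suc (dist u t)"
proof -
  have uv: "u \<in> V" "v \<in> V" using assms finite_graph by (auto simp: finite_graph_def)
  have "graph_walk V E [u, v]" using assms uv by (simp add: graph_walk_def)
  from gdist_le[OF this] have "dist u v \<le> 1" by simp
  moreover have "dist v u \<le> 1" using calculation gdist_commute[of V E] by metis
  ultimately have "dist u t \<le> 1 + dist v t" "dist v t \<le> 1 + dist u t"
    using dist_triangle[OF uv assms(2)] dist_triangle[of v u t] uv assms(2) by auto
  moreover obtain A where A: "\<And>u v. {u, v} \<in> E \<Longrightarrow> u \<in> A \<longleftrightarrow> v \<notin> A"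
    using bipartition by metis
  have "dist u t \<noteq> dist v t"
    using even_dist_iff[OF A, of u t] even_dist_iff[OF A, of v t] A[OF assms(1)] uv assms(2)
    by auto
  ultimately show ?thesis by linarith
qed

lemma dist_le_diameter:
  assumes "u \<in> V" "v \<in> V"
  shows "dist u v \<le> graph_diameter V E"
proof -
  have "{dist u v | u v. u \<in> V \<and> v \<in> V} = (\<lambda>(u, v). dist u v) ` (V \<times> V)" by auto
  then have "finite {dist u v | u v. u \<in> V \<and> v \<in> V}"
    using finite_graph by (simp add: finite_graph_def)
  then show ?thesis unfolding graph_diameter_def by (rule Max_ge) (use assms in blast)
qed

section \<open>Collecting cups\<close>

text \<open>Allowing every \<open>c\<close> with single cups on \<open>S\<close>, and prescribing
  the exact result, lets disjoint sets be collected onto \<open>t\<close> one after another, however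
  many cups \<open>t\<close> already carries.\<close>

definition collectable :: "'a set \<Rightarrow> 'a \<Rightarrow> bool" where
  "collectable S t \<longleftrightarrow> t \<in> V \<and> finite S \<and> t \<notin> S \<and>
    (\<forall>c. (\<forall>v\<in>S. c v = 1) \<and> c t \<ge> 1 \<longrightarrow>
      (cup_move V E)\<^sup>*\<^sup>* c (\<lambda>v. if v = t then c t + card S else if v \<in> S then 0 else c v))"

lemma collectable_empty: "t \<in> V \<Longrightarrow> collectable {} t"
proof -
  have "(\<lambda>v. if v = t then c t + card {} else if v \<in> {} then 0 else c v) = c"
    for c :: "'a \<Rightarrow> nat"
    by auto
  then show "t \<in> V \<Longrightarrow> collectable {} t"
    unfolding collectable_def by (metis empty_iff finite.emptyI rtranclp.rtrancl_refl)
qed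

lemma collectable_Un:
  assumes S: "collectable S t" and T: "collectable T t" and disj: "S \<inter> T = {}"
  shows "collectable (S \<union> T) t"
  unfolding collectable_def
proof (intro conjI allI impI)
  fix c :: "'a \<Rightarrow> nat"
  assume c: "(\<forall>v\<in>S \<union> T. c v = 1) \<and> c t \<ge> 1"
  define c1 where "c1 = (\<lambda>v. if v = t then c t + card S else if v \<in> S then 0 else c v)"
  define c2 where "c2 = (\<lambda>v. if v = t then c1 t + card T else if v \<in> T then 0 else c1 v)"
  have "(cup_move V E)\<^sup>*\<^sup>* c c1" using S c by (auto simp: collectable_def c1_def)
  moreover have "(cup_move V E)\<^sup>*\<^sup>* c1 c2"
  proof -
    have "(\<forall>v\<in>T. c1 v = 1) \<and> c1 t \<ge> 1"
      using c disj T by (auto simp: c1_def collectable_def)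
    then show ?thesis using T by (auto simp: collectable_def c2_def)
  qed
  moreover have "c2 = (\<lambda>v. if v = t then c t + card (S \<union> T) else if v \<in> S \<union> T then 0 else c v)"
    using S T disj by (auto simp: c1_def c2_def collectable_def card_Un_disjoint)
  ultimately show "(cup_move V E)\<^sup>*\<^sup>* c
    (\<lambda>v. if v = t then c t + card (S \<union> T) else if v \<in> S \<union> T then 0 else c v)" by simp
qed (use S T in \<open>auto simp: collectable_def\<close>)

text \<open>Gathering \<open>S\<close> on \<open>x\<close> makes a stack of
  \<open>card S + 1\<close> cups, which is just the distance to \<open>t\<close>.\<close>

lemma collectable_jump:
  assumes S: "collectable S x" and t: "t \<in> V" "t \<noteq> x" "t \<notin> S" and "dist x t = Suc (card S)"
  shows "collectable (insert x S) t"
  unfolding collectable_def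
proof (intro conjI allI impI)
  fix c :: "'a \<Rightarrow> nat"
  assume c: "(\<forall>v\<in>insert x S. c v = 1) \<and> c t \<ge> 1"
  define c1 where "c1 = (\<lambda>v. if v = x then c x + card S else if v \<in> S then 0 else c v)"
  have "(cup_move V E)\<^sup>*\<^sup>* c c1" using S c by (auto simp: collectable_def c1_def)
  moreover have "cup_move V E c1 (c1(x := 0, t := c1 t + c1 x))"
    unfolding cup_move_def
    by (rule bexI[of _ x], rule bexI[of _ t])
      (use S t c assms(5) in \<open>auto simp: c1_def collectable_def\<close>)
  moreover have "c1(x := 0, t := c1 t + c1 x) =
    (\<lambda>v. if v = t then c t + card (insert x S) else if v \<in> insert x S then 0 else c v)"
    using S t c by (auto simp: c1_def collectable_def)
  ultimately show "(cup_move V E)\<^sup>*\<^sup>* c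
    (\<lambda>v. if v = t then c t + card (insert x S) else if v \<in> insert x S then 0 else c v)"
    by (metis rtranclp.rtrancl_into_rtrancl)
qed (use S t in \<open>auto simp: collectable_def\<close>)

lemma collectable_path_Cons:
  "graph_path V E (t # ys) \<Longrightarrow> collectable (set ys) t"
proof (induction "length ys" arbitrary: t ys rule: less_induct)
  case less
  have tV: "t \<in> V" using less.prems by (auto simp: graph_path_def graph_walk_def)
  show ?case
  proof (cases "ys = []")
    case True
    then show ?thesis using collectable_empty tV by simp
  next
    case False
    define z k where "z = last ys" and "k = dist z t"
    have zin: "z \<in> set ys" using False by (simp add: z_def)
    have dis: "distinct (t # ys)" using less.prems by (simp add: graph_path_def)
    have sub: "set ys \<subseteq> V" using less.prems by (auto simp: graph_path_def graph_walk_def)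
    have zt: "z \<noteq> t" using zin dis by auto
    have "k \<noteq> 0" using dist_eq_0[of z t] zt zin sub tV by (auto simp: k_def)
    \<comment> \<open>The path is itself a walk from \<open>t\<close> to \<open>z\<close>, so the
      last \<open>k\<close> vertices do not include \<open>t\<close>.\<close>
    moreover have "k \<le> length ys"
      using gdist_le[of V E "t # ys" t z] less.prems False gdist_commute[of V E z t]
      by (simp add: graph_path_def z_def k_def)
    ultimately obtain as zs where split: "ys = as @ zs @ [z]" and len: "Suc (length zs) = k"
    proof -
      assume k: "k \<noteq> 0" "k \<le> length ys"
        and *: "\<And>as zs. ys = as @ zs @ [z] \<Longrightarrow> Suc (length zs) = k \<Longrightarrow> thesis"
      define b where "b = butlast ys"
      have "ys = b @ [z]" using False by (simp add: b_def z_def)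
      moreover from this have "length ys = Suc (length b)" by simp
      ultimately show thesis using k *[of "take (Suc (length b) - k) b" "drop (Suc (length b) - k) b"]
        by auto
    qed
    have path: "graph_path V E ((t # as) @ zs @ [z])" using less.prems split by simp
    \<comment> \<open>The final \<open>k\<close> vertices are read backwards, so that the induction
      hypothesis gathers them on \<open>z\<close>.\<close>
    have "graph_path V E (z # rev zs)"
      using graph_path_appendD(2)[OF path] graph_path_rev[of V E "zs @ [z]"] by simp
    moreover have "length (rev zs) < length ys" using split by simp
    ultimately have "collectable (set zs) z" using less.hyps[of "rev zs" z] by simp
    then have 1: "collectable (insert z (set zs)) t"
      by (rule collectable_jump)
        (use tV zt dis split len distinct_card[of zs] in \<open>auto simp: k_def\<close>)
    have "graph_path V E (t # as)" using graph_path_appendD(1)[OF path] by simp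
    moreover have "length as < length ys" using split by simp
    ultimately have "collectable (set as) t" using less.hyps[of as t] by simp
    from collectable_Un[OF this 1] show ?thesis using dis split by auto
  qed
qed

text \<open>The vertex \<open>x\<close> cuts the path into two sides, and each side together with
  \<open>x\<close> is a path ending at \<open>x\<close>.\<close>

lemma collectable_path:
  assumes "graph_path V E xs" "x \<in> set xs"
  shows "collectable (set xs - {x}) x"
proof -
  obtain as bs where xs: "xs = as @ x # bs" using assms(2) split_list by metis
  have dis: "distinct xs" using assms by (simp add: graph_path_def)
  have "graph_path V E (as @ [x])" using assms xs graph_path_appendD(1)[of V E "as @ [x]" bs] by simp
  then have "graph_path V E (x # rev as)" using graph_path_rev[of V E "as @ [x]"] by simp
  then have "collectable (set as) x" using collectable_path_Cons by fastforce
  moreover have "collectable (set bs) x"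
    using assms xs graph_path_appendD(2)[of V E as "x # bs"] collectable_path_Cons by simp
  moreover have "set xs - {x} = set as \<union> set bs" "set as \<inter> set bs = {}" using dis xs by auto
  ultimately show ?thesis using collectable_Un by metis
qed

section \<open>Paths avoiding the target\<close>

text \<open>Each segment is gathered on the vertex that measures it, and the resulting stack jumps
  to \<open>t\<close>.\<close>

lemma collectable_take_of_tileable:
  assumes path: "graph_path V E xs" and t: "t \<in> V" "t \<notin> set xs"
    and "tileable (\<lambda>i. dist (xs ! i) t) n" "n \<le> length xs"
  shows "collectable (set (take n xs)) t"
  using assms(4,5)
proof (induction rule: tileable.induct)
  case zero
  then show ?case using collectable_empty t by simp
next
  case (tile k j)
  define m where "m = dist (xs ! j) t"
  define ys where "ys = take m (drop k xs)"
  have m: "k + m \<le> length xs" "j < k + m" using tile by (auto simp: m_def)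
  have len: "length ys = m" using m by (simp add: ys_def)
  have split: "xs = take k xs @ ys @ drop (k + m) xs"
    by (metis append_take_drop_id drop_drop add.commute ys_def)
  have tk: "take (k + m) xs = take k xs @ ys" by (simp add: ys_def take_add)
  have dis: "distinct xs" using path by (simp add: graph_path_def)
  have "ys \<noteq> []" using m tile len by auto
  then have py: "graph_path V E ys"
    using path split graph_path_appendD(2)[of V E "take k xs" "ys @ drop (k + m) xs"]
      graph_path_appendD(1)[of V E ys "drop (k + m) xs"] by simp
  \<comment> \<open>The index \<open>j\<close> counts along the whole path, whereas
    \<open>ys\<close> begins at position \<open>k\<close>.\<close>
  have "ys ! (j - k) = xs ! j" using m tile by (simp add: ys_def)
  then have xj: "xs ! j \<in> set ys" using m tile len nth_mem[of "j - k" ys] by auto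
  have sub: "set ys \<subseteq> set xs" unfolding ys_def by (meson set_drop_subset set_take_subset subset_trans)
  have disy: "distinct ys" using py by (simp add: graph_path_def)
  have "Suc (card (set ys - {xs ! j})) = m"
    using card_Suc_Diff1[OF _ xj] distinct_card[OF disy] len by simp
  then have "collectable (insert (xs ! j) (set ys - {xs ! j})) t"
    using collectable_path[OF py xj] t sub xj
    by (intro collectable_jump) (auto simp: m_def)
  then have "collectable (set ys) t" using xj by (simp add: insert_absorb)
  moreover have "collectable (set (take k xs)) t" using tile by simp
  moreover have "set (take k xs) \<inter> set ys = {}"
    using dis tk distinct_take[of xs "k + m"] by auto
  ultimately have "collectable (set (take k xs) \<union> set ys) t" using collectable_Un by blast
  then show ?case using tk by (simp add: m_def)
qed

lemma collectable_long_path: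
  assumes path: "graph_path V E xs" and t: "t \<in> V" "t \<notin> set xs"
    and len: "length xs \<ge> (graph_diameter V E)\<^sup>2"
    and start: "\<not> (length xs \<ge> 2 \<and> dist (xs ! 0) t = 2 \<and> dist (xs ! 1) t = 1)"
  shows "collectable (set xs) t"
proof -
  have V: "xs ! i \<in> V" if "i < length xs" for i
    using path that by (auto simp: graph_path_def graph_walk_def)
  have "tileable (\<lambda>i. dist (xs ! i) t) (length xs)"
  proof (rule tileable_of_unit_steps_below[OF _ len])
    show "1 \<le> length xs" using path by (cases xs) (auto simp: graph_path_def graph_walk_def)
    fix i
    show "1 \<le> dist (xs ! i) t \<and> dist (xs ! i) t \<le> graph_diameter V E" if "i < length xs"
      using dist_le_diameter dist_eq_0[OF V[OF that] t(1)] V[OF that] t that nth_mem[OF that]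
      by (metis One_nat_def Suc_leI not_gr_zero)
    assume "Suc i < length xs"
    then have "{xs ! i, xs ! Suc i} \<in> E"
      using path by (auto simp: graph_path_def graph_walk_def successively_conv_nth)
    then show "dist (xs ! Suc i) t = Suc (dist (xs ! i) t) \<or>
        dist (xs ! i) t = Suc (dist (xs ! Suc i) t)"
      using dist_edge t(1) by blast
  qed (use start in auto)
  from collectable_take_of_tileable[OF path t this] show ?thesis by simp
qed

text \<open>Being collectable depends only on the vertex set, so the path may be reversed; it
  suffices that one of its ends is not at distance 2 from \<open>t\<close>.\<close>

lemma collectable_long_path_ends:
  assumes path: "graph_path V E xs" and t: "t \<in> V" "t \<notin> set xs"
    and len: "length xs \<ge> (graph_diameter V E)\<^sup>2"
    and ends: "dist (hd xs) (last xs) \<notin> {2, 4}"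
  shows "collectable (set xs) t"
proof -
  have ne: "xs \<noteq> []" and sub: "set xs \<subseteq> V" and dis: "distinct xs"
    using path by (auto simp: graph_path_def graph_walk_def)
  \<comment> \<open>If both ends are at distance 2 from \<open>t\<close>, their mutual distance is
    even by parity, at most 4 by way of \<open>t\<close>, and nonzero because they are
    distinct.\<close>
  have False if "length xs \<ge> 2" "dist (hd xs) t = 2" "dist (last xs) t = 2"
  proof -
    have V: "hd xs \<in> V" "last xs \<in> V" using ne sub by auto
    obtain A where A: "\<And>u v. {u, v} \<in> E \<Longrightarrow> u \<in> A \<longleftrightarrow> v \<notin> A" using bipartition by metis
    have "even (dist (hd xs) (last xs))"
      using even_dist_iff[OF A] V t that by (metis even_numeral)
    moreover have "dist (hd xs) (last xs) \<le> 4"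
      using dist_triangle[OF V(1) t(1) V(2)] that gdist_commute[of V E t] by simp
    moreover have "hd xs \<noteq> last xs"
      using that dis ne by (cases xs) auto
    then have "dist (hd xs) (last xs) \<noteq> 0" using dist_eq_0 V by simp
    ultimately have "dist (hd xs) (last xs) \<in> {2, 4}" by (auto elim!: evenE)
    then show False using ends by simp
  qed
  then consider "\<not> (length xs \<ge> 2 \<and> dist (xs ! 0) t = 2)"
    | "\<not> (length (rev xs) \<ge> 2 \<and> dist (rev xs ! 0) t = 2)"
    using ne by (auto simp: hd_conv_nth last_conv_nth rev_nth)
  then show ?thesis
    using collectable_long_path[OF path t len] collectable_long_path[of "rev xs" t] path t len
    by cases (auto simp: graph_path_rev)
qed

section \<open>Assembling the paths of the partition\<close>

lemma collectable_UN:
  assumes "finite I" "\<And>i. i \<in> I \<Longrightarrow> collectable (S i) t" "disjoint_family_on S I" "t \<in> V"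
  shows "collectable (\<Union>i\<in>I. S i) t"
  using assms
proof (induction I rule: finite_induct)
  case empty
  then show ?case using collectable_empty by simp
next
  case (insert i I)
  have "S i \<inter> (\<Union>i\<in>I. S i) = {}" using insert by (auto simp: disjoint_family_on_def)
  moreover have "collectable (\<Union>i\<in>I. S i) t"
    using insert by (auto simp: disjoint_family_on_def)
  ultimately show ?case using collectable_Un[of "S i" t "\<Union>i\<in>I. S i"] insert by simp
qed

lemma stackable_of_collectable:
  assumes "collectable (V - {t}) t"
  shows "stackable V E t"
proof -
  let ?c = "initial_cups V"
  have "(\<forall>v\<in>V - {t}. ?c v = 1) \<and> ?c t \<ge> 1"
    using assms by (auto simp: initial_cups_def collectable_def)
  then have "(cup_move V E)\<^sup>*\<^sup>* ?c
    (\<lambda>v. if v = t then ?c t + card (V - {t}) else if v \<in> V - {t} then 0 else ?c v)"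
    using assms unfolding collectable_def by blast
  then show ?thesis unfolding stackable_def by (intro exI conjI) auto
qed

end

theorem theorem3p3:
  fixes V :: "'a set" and E :: "'a set set" and t :: 'a
    and d p :: nat and P :: "nat \<Rightarrow> 'a list"
  assumes "finite_graph V E" and "connected_graph V E" and "bipartite_graph V E"
    and "graph_diameter V E = d"
    and "t \<in> V"
    and "p \<ge> 2"
    and "path_partition V E p P"
    and "t \<in> set (P 1)"
    and "\<And>j. j \<in> {2..p} \<Longrightarrow> length (P j) \<ge> d\<^sup>2"
    and "\<And>j. j \<in> {2..p} \<Longrightarrow> gdist V E (hd (P j)) (last (P j)) \<notin> {2, 4}"
  shows "stackable V E t"
proof -
  interpret connected_bipartite_graph V E using assms(1-3) by unfold_locales
  have paths: "\<And>i. i \<in> {1..p} \<Longrightarrow> graph_path V E (P i)"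
    and disj: "disjoint_family_on (\<lambda>i. set (P i)) {1..p}"
    and cover: "(\<Union>i\<in>{1..p}. set (P i)) = V"
    using assms(7) by (auto simp: path_partition_def)
  have t_unique: "t \<notin> set (P j)" if "j \<in> {2..p}" for j
  proof -
    have "set (P 1) \<inter> set (P j) = {}"
      by (rule disjoint_family_onD[OF disj]) (use that in auto)
    then show ?thesis using assms(8) by blast
  qed
  \<comment> \<open>The path through \<open>t\<close> is gathered on its own vertex \<open>t\<close>
    whatever its length; the other paths avoid \<open>t\<close> and are cut into segments.\<close>
  have "collectable (set (P i) - {t}) t" if "i \<in> {1..p}" for i
  proof (cases "i = 1")
    case True
    then show ?thesis using collectable_path paths that assms(8) by blast
  next
    case False
    then have i: "i \<in> {2..p}" using that by auto
    have "collectable (set (P i)) t"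
      using collectable_long_path_ends[OF paths[OF that] assms(5) t_unique[OF i]] assms(4)
        assms(9,10)[OF i] by simp
    then show ?thesis using t_unique[OF i] by simp
  qed
  then have "collectable (\<Union>i\<in>{1..p}. set (P i) - {t}) t"
    using disj assms(5) by (intro collectable_UN) (auto simp: disjoint_family_on_def)
  moreover have "(\<Union>i\<in>{1..p}. set (P i) - {t}) = V - {t}" using cover by auto
  ultimately show ?thesis using stackable_of_collectable by simp
qed

end
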